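(* Let $(\mathcal{B},\nu)$ be an effective topology with a recursively enumerable subset relation, and let $\phi$ be an oracle for a point $x$ in $(\mathcal{B},\nu)$. Then there exists a complete oracle $\psi$ for $x$ in $(\mathcal{B},\nu)$ that is recursive relative to $\phi$ uniformly.
   Context: Let $X$ be a set with a topology having a countable basis $\mathcal{B}$. A coding of $\mathcal{B}$ is a (not necessarily injective) assignment $n\mapsto\nu(n)$ of basis elements to non-negative integers, every basis element being coded by at least one integer; $\mathrm{dom}_{\mathcal{B}}\nu$ denotes the set of non-negative integers $n$ with $\nu(n)\in\mathcal{B}$. $(\mathcal{B},\nu)$ is an effective topology iff $\mathcal{B}$ is a countable basis for a $T_0$ topology and $\nu$ is a coding of $\mathcal{B}$. A set $\mathcal{L}_x\subseteq\mathcal{B}$ is a local basis for $x\in X$ iff every $L\in\mathcal{L}_x$ contains $x$ and for every $B\in\mathcal{B}$ with $x\in B$ there exists $L\in\mathcal{L}_x$ with $L\subseteq B$. Writing $\mathbb{N}$ for the non-negative integers and $\nu(C)=\{\nu(c):c\in C\}$, a function $\phi:\mathbb{N}\to\mathrm{dom}_{\mathcal{B}}\nu$ is an oracle for $x$ iff $\nu(\phi(\mathbb{N}))$ is a local basis for $x$; it is complete iff every $n\in\mathrm{dom}_{\mathcal{B}}\nu$ with $x\in\nu(n)$ lies in $\phi(\mathbb{N})$. The effective topology has a recursively enumerable subset relation iff $\{\langle b_1,b_2\rangle: b_1,b_2\in\mathrm{dom}_{\mathcal{B}}\nu,\ \nu(b_1)\subseteq\nu(b_2)\}$ is recursively enumerable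 (with $\langle\cdot,\cdot\rangle$ Cantor's pairing function). "Recursive relative to $\phi$ uniformly" means computed from $\phi$ by an oracle Turing machine that does not depend on $\phi$ (or $x$). *)

theory Defs
  imports "HOL-Analysis.Analysis" "HOL-Library.Nat_Bijection"
begin

section \<open>Oracle Turing machines\<close>

text \<open>
  Deterministic multi-tape machines with finitely many states \<open>{..<states M}\<close> (start state 0) and
  finitely many tape symbols \<open>{..<symbols M}\<close>, where 0 is the blank and 1 is the stroke. Tape 0
  carries the input and finally the output, tape 1 carries the queries and their answers.
  Tapes are two-way infinite, and are always given relative to the head: cell 0 is the scanned
  cell, so that moving the head is a shift of the tape.
\<close>

type_synonym tape = "int \<Rightarrow> nat"

datatype move = Left | Stay | Right

datatype action =
    Halt
  | Go nat "(nat \<times> move) list"  \<comment> \<open>next state; for each tape the symbol to write and the head move\<close>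
  | Query nat                  \<comment> \<open>consult the oracle and continue in the given state\<close>

record machine =
  tapes :: nat
  symbols :: nat
  states :: nat
  program :: "nat \<Rightarrow> nat list \<Rightarrow> action"  \<comment> \<open>state and scanned symbols (one for each tape)\<close>

definition scannable :: "machine \<Rightarrow> nat list \<Rightarrow> bool" where
  "scannable M rs \<longleftrightarrow> length rs = tapes M \<and> set rs \<subseteq> {..<symbols M}"

text \<open>The program only matters on the finitely many pairs of a state and scannable symbols.\<close>

definition oracle_machine :: "machine \<Rightarrow> bool" where
  "oracle_machine M \<longleftrightarrow> 2 \<le> tapes M \<and> 2 \<le> symbols M \<and> 0 < states M \<and>
     (\<forall>q rs. q < states M \<and> scannable M rs \<longrightarrow>
        (case program M q rs of
           Halt \<Rightarrow> True
         | Go q' ws \<Rightarrow> q' < states M \<and> length ws = tapes M \<and> fst ` set ws \<subseteq> {..<symbols M}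
         | Query q' \<Rightarrow> q' < states M))"

definition plain_machine :: "machine \<Rightarrow> bool" where
  "plain_machine M \<longleftrightarrow> oracle_machine M \<and>
     (\<forall>q rs. q < states M \<and> scannable M rs \<longrightarrow> (\<forall>q'. program M q rs \<noteq> Query q'))"

definition unary :: "nat \<Rightarrow> tape" where
  "unary n = (\<lambda>i. if 0 \<le> i \<and> i < int n then 1 else 0)"

text \<open>The number of consecutive strokes that starts at the scanned cell.\<close>

definition strokes :: "tape \<Rightarrow> nat" where
  "strokes t = (LEAST n. t (int n) \<noteq> 1)"

fun shift :: "move \<Rightarrow> tape \<Rightarrow> tape" where
  "shift Left t = (\<lambda>i. t (i - 1))"
| "shift Stay t = t"
| "shift Right t = (\<lambda>i. t (i + 1))"

fun write_move :: "nat \<times> move \<Rightarrow> tape \<Rightarrow> tape" where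
  "write_move (s, d) t = shift d (t(0 := s))"

type_synonym config = "nat \<times> tape list"

fun next_action :: "machine \<Rightarrow> config \<Rightarrow> action" where
  "next_action M (q, ts) = program M q (map (\<lambda>t. t 0) ts)"

text \<open>A query replaces tape 1, carrying \<open>n\<close> in unary, by the answer \<open>\<phi> n\<close> in unary.\<close>

fun step :: "machine \<Rightarrow> (nat \<Rightarrow> nat) \<Rightarrow> config \<Rightarrow> config" where
  "step M \<phi> (q, ts) =
     (case next_action M (q, ts) of
        Halt \<Rightarrow> (q, ts)
      | Go q' ws \<Rightarrow> (q', map2 write_move ws ts)
      | Query q' \<Rightarrow> (q', ts[1 := unary (\<phi> (strokes (ts ! 1)))]))"

definition start :: "machine \<Rightarrow> nat \<Rightarrow> config" where
  "start M n = (0, unary n # replicate (tapes M - 1) (unary 0))"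

definition outputs :: "machine \<Rightarrow> (nat \<Rightarrow> nat) \<Rightarrow> nat \<Rightarrow> nat \<Rightarrow> bool" where
  "outputs M \<phi> n m \<longleftrightarrow>
     (\<exists>k. let c = (step M \<phi> ^^ k) (start M n) in next_action M c = Halt \<and> snd c ! 0 = unary m)"

definition computes :: "machine \<Rightarrow> (nat \<Rightarrow> nat) \<Rightarrow> (nat \<Rightarrow> nat) \<Rightarrow> bool" where
  "computes M \<phi> \<psi> \<longleftrightarrow> (\<forall>n. outputs M \<phi> n (\<psi> n))"

lemma unary_inject: "unary m = unary n \<longleftrightarrow> m = n"
proof
  assume "unary m = unary n"
  then have "(i < m) = (i < n)" for i :: nat
    by (auto simp: unary_def fun_eq_iff split: if_splits dest!: spec[of _ "int i"])
  then show "m = n"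
    by (metis linorder_neqE_nat order_less_irrefl)
qed simp

lemma strokes_unary: "strokes (unary n) = n"
  unfolding strokes_def unary_def by (rule Least_equality) (auto simp: not_less[symmetric])

lemma step_halted: "next_action M c = Halt \<Longrightarrow> (step M \<phi> ^^ k) c = c"
  by (induction k) (cases c, auto)+

lemma outputs_unique:
  assumes "outputs M \<phi> n m" "outputs M \<phi> n m'"
  shows "m = m'"
proof -
  define c where "c k = (step M \<phi> ^^ k) (start M n)" for k
  have stable: "c (j + k) = c k" if "next_action M (c k) = Halt" for j k
    using step_halted[OF that, where \<phi> = \<phi> and k = j] by (simp add: c_def funpow_add)
  obtain k k' where "next_action M (c k) = Halt" "snd (c k) ! 0 = unary m"
    "next_action M (c k') = Halt" "snd (c k') ! 0 = unary m'"
    using assms by (auto simp: outputs_def c_def Let_def)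
  then show ?thesis
    by (metis stable add.commute unary_inject)
qed

text \<open>A plain machine never consults its oracle, so that the choice of the latter is immaterial.\<close>

definition recursive :: "(nat \<Rightarrow> nat) \<Rightarrow> bool" where
  "recursive f \<longleftrightarrow> (\<exists>M. plain_machine M \<and> computes M (\<lambda>_. 0) f)"

definition recursively_enumerable :: "nat set \<Rightarrow> bool" where
  "recursively_enumerable S \<longleftrightarrow> S = {} \<or> (\<exists>f. recursive f \<and> S = range f)"


section \<open>Effective topologies\<close>

definition countable_basis :: "'a topology \<Rightarrow> 'a set set \<Rightarrow> bool" where
  "countable_basis X \<B> \<longleftrightarrow> countable \<B> \<and> (\<forall>B\<in>\<B>. openin X B) \<and>
     (\<forall>U x. openin X U \<and> x \<in> U \<longrightarrow> (\<exists>B\<in>\<B>. x \<in> B \<and> B \<subseteq> U))"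

text \<open>Not every integer need be a code.\<close>

definition coding :: "'a set set \<Rightarrow> (nat \<rightharpoonup> 'a set) \<Rightarrow> bool" where
  "coding \<B> \<nu> \<longleftrightarrow> ran \<nu> = \<B>"

definition code_dom :: "'a set set \<Rightarrow> (nat \<rightharpoonup> 'a set) \<Rightarrow> nat set" where
  "code_dom \<B> \<nu> = {n. \<exists>B\<in>\<B>. \<nu> n = Some B}"

definition effective_topology :: "'a topology \<Rightarrow> 'a set set \<Rightarrow> (nat \<rightharpoonup> 'a set) \<Rightarrow> bool" where
  "effective_topology X \<B> \<nu> \<longleftrightarrow> t0_space X \<and> countable_basis X \<B> \<and> coding \<B> \<nu>"

definition re_subset_relation :: "'a set set \<Rightarrow> (nat \<rightharpoonup> 'a set) \<Rightarrow> bool" where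
  "re_subset_relation \<B> \<nu> \<longleftrightarrow> recursively_enumerable
     {prod_encode (b1, b2) | b1 b2.
        b1 \<in> code_dom \<B> \<nu> \<and> b2 \<in> code_dom \<B> \<nu> \<and> the (\<nu> b1) \<subseteq> the (\<nu> b2)}"

definition local_basis :: "'a set set \<Rightarrow> 'a \<Rightarrow> 'a set set \<Rightarrow> bool" where
  "local_basis \<B> x \<L> \<longleftrightarrow> \<L> \<subseteq> \<B> \<and> (\<forall>L\<in>\<L>. x \<in> L) \<and> (\<forall>B\<in>\<B>. x \<in> B \<longrightarrow> (\<exists>L\<in>\<L>. L \<subseteq> B))"

definition oracle_for :: "'a set set \<Rightarrow> (nat \<rightharpoonup> 'a set) \<Rightarrow> 'a \<Rightarrow> (nat \<Rightarrow> nat) \<Rightarrow> bool" where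
  "oracle_for \<B> \<nu> x \<phi> \<longleftrightarrow>
     range \<phi> \<subseteq> code_dom \<B> \<nu> \<and> local_basis \<B> x ((\<lambda>n. the (\<nu> n)) ` range \<phi>)"

definition complete_oracle_for :: "'a set set \<Rightarrow> (nat \<rightharpoonup> 'a set) \<Rightarrow> 'a \<Rightarrow> (nat \<Rightarrow> nat) \<Rightarrow> bool" where
  "complete_oracle_for \<B> \<nu> x \<phi> \<longleftrightarrow>
     oracle_for \<B> \<nu> x \<phi> \<and> (\<forall>n\<in>code_dom \<B> \<nu>. x \<in> the (\<nu> n) \<longrightarrow> n \<in> range \<phi>)"

end

theory Submission
  imports Defs
begin

text \<open>
  Let \<open>f\<close> enumerate the (codes of) pairs in the subset relation. On input \<open>\<langle>i, j\<rangle>\<close> the machine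
  computes \<open>f j = \<langle>a, b\<rangle>\<close> and queries \<open>\<phi> i\<close>; it outputs \<open>b\<close> if \<open>a = \<phi> i\<close>, and \<open>\<phi> i\<close> otherwise. Every
  output codes a superset of \<open>\<nu> (\<phi> i)\<close>, hence a neighbourhood of \<open>x\<close>; conversely, if \<open>b\<close> codes a
  neighbourhood of \<open>x\<close>, then \<open>\<nu> (\<phi> i) \<subseteq> \<nu> b\<close> for some \<open>i\<close>, and \<open>\<langle>\<phi> i, b\<rangle>\<close> is listed by \<open>f\<close>.
\<close>

section \<open>Runs and tapes\<close>

definition reaches :: "machine \<Rightarrow> (nat \<Rightarrow> nat) \<Rightarrow> config \<Rightarrow> config \<Rightarrow> bool" where
  "reaches M \<phi> c c' \<longleftrightarrow> (\<exists>k. (step M \<phi> ^^ k) c = c')"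

lemma reaches_refl: "reaches M \<phi> c c"
  unfolding reaches_def by (rule exI[of _ 0]) simp

lemma reaches_trans: "reaches M \<phi> c c' \<Longrightarrow> reaches M \<phi> c' c'' \<Longrightarrow> reaches M \<phi> c c''"
  unfolding reaches_def by (metis comp_apply funpow_add)

lemma reaches_step: "reaches M \<phi> c (step M \<phi> c)"
  unfolding reaches_def by (rule exI[of _ 1]) simp

lemma outputs_iff_reaches:
  "outputs M \<phi> n m \<longleftrightarrow>
     (\<exists>c. reaches M \<phi> (start M n) c \<and> next_action M c = Halt \<and> snd c ! 0 = unary m)"
  unfolding outputs_def reaches_def Let_def by blast

text \<open>Indexing tapes by a function turns changes of single tapes into function updates; only
  the indices below \<open>K\<close> count.\<close>

definition conf :: "nat \<Rightarrow> nat \<Rightarrow> (nat \<Rightarrow> tape) \<Rightarrow> config" where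
  "conf K q T = (q, map T [0..<K])"

definition go :: "nat \<Rightarrow> nat \<times> (nat \<Rightarrow> nat \<times> move) \<Rightarrow> action" where
  "go K p = Go (fst p) (map (snd p) [0..<K])"

lemma next_action_conf: "next_action M (conf K q T) = program M q (map (\<lambda>l. T l 0) [0..<K])"
  by (simp add: conf_def comp_def)

lemma step_go:
  assumes "program M q (map (\<lambda>l. T l 0) [0..<K]) = go K p"
  shows "step M \<phi> (conf K q T) = conf K (fst p) (\<lambda>l. write_move (snd p l) (T l))"
proof -
  have "map2 write_move (map w [0..<K]) (map T [0..<K]) = map (\<lambda>l. write_move (w l) (T l)) [0..<K]"
    for w
    by (rule nth_equalityI) auto
  with assms show ?thesis
    by (simp add: conf_def comp_def go_def)
qed

text \<open>Prepends one step to a known run. Where the premises are rotated, the remaining run is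
  resolved first, which fixes \<open>T'\<close> before the tape equations are simplified.\<close>

lemma reaches_go:
  assumes "program M q (map (\<lambda>l. T l 0) [0..<K]) = go K p"
    and "fst p = q'" and "\<And>l. l < K \<Longrightarrow> write_move (snd p l) (T l) = T' l"
    and "reaches M \<phi> (conf K q' T') c"
  shows "reaches M \<phi> (conf K q T) c"
proof -
  have "step M \<phi> (conf K q T) = conf K q' T'"
    using step_go[of M q T K p, OF assms(1)] assms(2,3) by (auto simp: conf_def)
  then show ?thesis
    by (metis assms(4) reaches_step reaches_trans)
qed

text \<open>Generalises \<open>unary\<close> to blocks not anchored at the head: a head move that
  preserves the scanned symbol shifts both bounds, and a negative \<open>a\<close> allows for
  strokes already crossed.\<close>

definition segment :: "int \<Rightarrow> int \<Rightarrow> tape" where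
  "segment a b = (\<lambda>i. if a \<le> i \<and> i < b then 1 else 0)"

lemma unary_segment: "unary n = segment 0 (int n)"
  by (simp add: unary_def segment_def)

lemma segment_scan: "segment a b 0 = (if a \<le> 0 \<and> 0 < b then 1 else 0)"
  by (simp add: segment_def)

lemma segment_empty: "segment 1 1 = segment 0 0"
  by (auto simp: segment_def)

lemma write_stay: "s = t 0 \<Longrightarrow> write_move (s, Stay) t = t"
  by simp

lemma segment_right:
  "s = segment a b 0 \<Longrightarrow> write_move (s, Right) (segment a b) = segment (a - 1) (b - 1)"
  by (auto simp: segment_def fun_eq_iff)

lemma segment_left:
  "s = segment a b 0 \<Longrightarrow> write_move (s, Left) (segment a b) = segment (a + 1) (b + 1)"
  by (auto simp: segment_def fun_eq_iff)

lemma segment_pop: "0 < b \<Longrightarrow> write_move (0, Right) (segment 0 b) = segment 0 (b - 1)"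
  by (auto simp: segment_def fun_eq_iff)

lemma segment_push: "1 \<le> b \<Longrightarrow> write_move (Suc 0, Left) (segment 1 b) = segment 1 (b + 1)"
  by (auto simp: segment_def fun_eq_iff)

lemma segment_close: "1 \<le> b \<Longrightarrow> write_move (Suc 0, Stay) (segment 1 b) = segment 0 b"
  by (auto simp: segment_def fun_eq_iff)

lemmas tape_simps = segment_scan write_stay segment_right segment_left segment_pop segment_push
  segment_close

text \<open>Tapes stay in \<open>segment\<close> form, since simplification uses
  \<open>tape_simps\<close> instead of unfolding single cells.\<close>

declare write_move.simps [simp del]


section \<open>Decoding pairs\<close>

text \<open>
  The inverse of Cantor's pairing function is computed by walking along its diagonals: a number
  \<open>n\<close> is counted down on tape \<open>i\<close>, while tapes \<open>j\<close> and \<open>k\<close> carry the current pair \<open>(a, b)\<close>, as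
  \<open>segment 1 (1 + a)\<close> (ready to be prolonged) and \<open>segment 0 b\<close> (ready to be shortened).
  At the end of a diagonal, state \<open>s + 1\<close> turns \<open>(a, 0)\<close> into \<open>(0, a + 1)\<close>.
\<close>

definition stay :: "(nat \<Rightarrow> nat) \<Rightarrow> nat \<Rightarrow> nat \<times> move" where
  "stay r = (\<lambda>l. (r l, Stay))"

definition walk ::
  "nat \<Rightarrow> nat \<Rightarrow> nat \<Rightarrow> nat \<Rightarrow> nat \<Rightarrow> (nat \<Rightarrow> nat) \<Rightarrow> nat \<times> (nat \<Rightarrow> nat \<times> move)" where
  "walk s e i j k r =
     (if r i = 0 then (e, (stay r)(j := (r j, Right)))
      else if r k = 0 then (s + 1, (stay r)(i := (0, Right), j := (r j, Right)))
      else (s, (stay r)(i := (0, Right), j := (1, Left), k := (0, Right))))"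

definition refill :: "nat \<Rightarrow> nat \<Rightarrow> nat \<Rightarrow> (nat \<Rightarrow> nat) \<Rightarrow> nat \<times> (nat \<Rightarrow> nat \<times> move)" where
  "refill s j k r =
     (if r j = 0 then (s, (stay r)(k := (1, Stay)))
      else (s + 1, (stay r)(j := (0, Right), k := (1, Left))))"

text \<open>The sum of the components is constant along a diagonal, so the code there grows with the
  first component alone.\<close>

lemma prod_encode_step: "prod_encode (Suc a, b) = Suc (prod_encode (a, Suc b))"
  by (simp add: prod_encode_def)

lemma prod_encode_wrap: "prod_encode (0, Suc a) = Suc (prod_encode (a, 0))"
  by (simp add: prod_encode_def)

text \<open>Strokes pass one by one from tape \<open>j\<close> to tape \<open>k\<close>; the stroke
  that closes the block on tape \<open>k\<close> supplies the additional 1.\<close>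

lemma reaches_refill:
  assumes prog: "\<And>r. program M (s + 1) (map r [0..<K]) = go K (refill s j k r)" and "j \<noteq> k"
  shows "reaches M \<phi> (conf K (s + 1) (T(j := segment 0 (int a), k := segment 1 (1 + int b))))
    (conf K s (T(j := segment 0 0, k := segment 0 (1 + int (a + b)))))"
proof (induction a arbitrary: b)
  case 0
  show ?case
    by (rule reaches_go[OF prog _ _ reaches_refl])
      (use assms(2) in \<open>auto simp: refill_def stay_def tape_simps\<close>)
next
  case (Suc a)
  show ?case
    by (rule reaches_go[OF prog, rotated 2], rule Suc.IH[of "Suc b", folded add_Suc_shift])
      (use assms(2) in \<open>auto simp: refill_def stay_def tape_simps\<close>)
qed

text \<open>The counter plus the code of the current pair is invariant. Once the counter is empty,
  injectivity of \<open>prod_encode\<close> identifies the pair.\<close>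

lemma reaches_walk:
  assumes walk: "\<And>r. program M s (map r [0..<K]) = go K (walk s e i j k r)"
    and refill: "\<And>r. program M (s + 1) (map r [0..<K]) = go K (refill s j k r)"
    and neq: "i \<noteq> j" "i \<noteq> k" "j \<noteq> k"
    and "prod_encode (a', b') = prod_encode (a, b) + n"
  shows "reaches M \<phi>
    (conf K s (T(i := unary n, j := segment 1 (1 + int a), k := unary b)))
    (conf K e (T(i := unary 0, j := unary a', k := unary b')))"
  using assms(6)
proof (induction n arbitrary: a b)
  case 0
  then have "a' = a" "b' = b"
    by auto
  then show ?case
    by (intro reaches_go[OF walk _ _ reaches_refl])
      (use neq in \<open>auto simp: walk_def stay_def tape_simps unary_segment\<close>)
next
  case (Suc n)
  show ?case
  proof (cases b)
    case 0
    \<comment> \<open>The step that leaves the diagonal already consumes a stroke of the counter, so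
      the refilling itself costs none.\<close>
    let ?T = "T(i := unary n)"
    have "reaches M \<phi>
      (conf K (s + 1) (?T(j := segment 0 (int a), k := segment 1 (1 + int 0))))
      (conf K s (?T(j := segment 0 0, k := segment 0 (1 + int (a + 0)))))"
      by (rule reaches_refill[OF refill neq(3)])
    moreover have "?T(j := segment 0 0, k := segment 0 (1 + int (a + 0)))
      = T(i := unary n, j := segment 1 (1 + int 0), k := unary (Suc a))"
      by (simp add: unary_segment segment_empty)
    ultimately have "reaches M \<phi>
      (conf K (s + 1) (?T(j := segment 0 (int a), k := segment 1 (1 + int 0))))
      (conf K s (T(i := unary n, j := segment 1 (1 + int 0), k := unary (Suc a))))"
      by (simp only:)
    moreover have "reaches M \<phi>
      (conf K s (T(i := unary n, j := segment 1 (1 + int 0), k := unary (Suc a))))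
      (conf K e (T(i := unary 0, j := unary a', k := unary b')))"
      by (rule Suc.IH) (use Suc.prems 0 in \<open>simp add: prod_encode_wrap\<close>)
    ultimately have "reaches M \<phi>
      (conf K (s + 1) (?T(j := segment 0 (int a), k := segment 1 (1 + int 0))))
      (conf K e (T(i := unary 0, j := unary a', k := unary b')))"
      by (rule reaches_trans)
    then show ?thesis
      by (rule reaches_go[OF walk, rotated 2])
        (use neq 0 in \<open>auto simp: walk_def stay_def tape_simps unary_segment segment_empty\<close>)
  next
    case (Suc b0)
    have "reaches M \<phi>
      (conf K s (T(i := unary n, j := segment 1 (1 + int (Suc a)), k := unary b0)))
      (conf K e (T(i := unary 0, j := unary a', k := unary b')))"
      by (rule Suc.IH) (use Suc.prems Suc in \<open>simp add: prod_encode_step\<close>)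
    then show ?thesis
      by (rule reaches_go[OF walk, rotated 2])
        (use neq Suc in \<open>auto simp: walk_def stay_def tape_simps unary_segment\<close>)
  qed
qed


section \<open>Running one machine inside another\<close>

text \<open>Bounding the symbols on all cells, not only the scanned ones, makes this invariant under
  head moves; \<open>oracle_machine\<close> constrains the program only on such
  configurations.\<close>

definition wf_conf :: "machine \<Rightarrow> config \<Rightarrow> bool" where
  "wf_conf M c \<longleftrightarrow> fst c < states M \<and> length (snd c) = tapes M \<and>
     (\<forall>t\<in>set (snd c). range t \<subseteq> {..<symbols M})"

lemma wf_conf_scannable: "wf_conf M (q, ts) \<Longrightarrow> scannable M (map (\<lambda>t. t 0) ts)"
  by (auto simp: wf_conf_def scannable_def)

lemma wf_conf_start: "oracle_machine M \<Longrightarrow> wf_conf M (start M n)"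
  by (auto simp: wf_conf_def start_def oracle_machine_def unary_def)

lemma range_write_move:
  assumes "range t \<subseteq> S" "fst w \<in> S"
  shows "range (write_move w t) \<subseteq> S"
proof (cases w)
  case (Pair s d)
  then show ?thesis
    using assms by (cases d) (auto simp: write_move.simps)
qed

lemma plain_machine_action:
  assumes "plain_machine M" "wf_conf M (q, ts)"
  shows "program M q (map (\<lambda>t. t 0) ts) = Halt \<or>
    (\<exists>q' ws. program M q (map (\<lambda>t. t 0) ts) = Go q' ws \<and> q' < states M \<and>
       length ws = tapes M \<and> fst ` set ws \<subseteq> {..<symbols M})"
proof -
  have "q < states M" "scannable M (map (\<lambda>t. t 0) ts)"
    using assms(2) wf_conf_scannable by (auto simp: wf_conf_def)
  then show ?thesis
    using assms(1) unfolding plain_machine_def oracle_machine_def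
    by (cases "program M q (map (\<lambda>t. t 0) ts)") (fastforce split: action.splits)+
qed

lemma wf_conf_step:
  assumes "plain_machine M" "wf_conf M c"
  shows "wf_conf M (step M \<phi> c)"
proof (cases c)
  case (Pair q ts)
  from plain_machine_action[OF assms(1), of q ts] assms(2)
  consider "program M q (map (\<lambda>t. t 0) ts) = Halt"
    | q' ws where "program M q (map (\<lambda>t. t 0) ts) = Go q' ws" "q' < states M"
      "length ws = tapes M" "fst ` set ws \<subseteq> {..<symbols M}"
    unfolding Pair by blast
  then show ?thesis
  proof cases
    case 1
    with assms(2) show ?thesis
      by (simp add: Pair)
  next
    case 2
    have "range (write_move w t) \<subseteq> {..<symbols M}" if "(w, t) \<in> set (zip ws ts)" for w t
      using 2(4) assms(2) set_zip_leftD[OF that] set_zip_rightD[OF that]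
      by (intro range_write_move) (auto simp: Pair wf_conf_def)
    with 2 assms(2) show ?thesis
      by (auto simp: Pair wf_conf_def image_subset_iff)
  qed
qed

text \<open>
  \<open>M\<close> runs on all tapes but the first three, with its states shifted by \<open>s\<close>, and leaves to state \<open>e\<close>
  instead of halting. Its queries need no simulation, since it is meant to be plain.
\<close>

definition embed :: "machine \<Rightarrow> nat \<Rightarrow> nat \<Rightarrow> nat \<Rightarrow> nat list \<Rightarrow> action" where
  "embed M s e q rs =
     (case program M q (drop 3 rs) of
        Halt \<Rightarrow> Go e (map (\<lambda>r. (r, Stay)) rs)
      | Go q' ws \<Rightarrow> Go (s + q') (map (\<lambda>r. (r, Stay)) (take 3 rs) @ ws)
      | Query q' \<Rightarrow> Halt)"

lemma map2_write_stay: "map2 write_move (map (\<lambda>t. (t 0, Stay)) ts) ts = ts"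
  by (induction ts) (auto simp: write_stay)

text \<open>Since \<open>M0\<close> is plain, the oracles \<open>\<phi>0\<close> and
  \<open>\<phi>\<close> are unrelated. A proper step of \<open>M0\<close> is matched by one step of
  \<open>M\<close>, an idle step of the halted \<open>M0\<close> by none.\<close>

lemma reaches_embed:
  assumes "plain_machine M0" and embed: "\<And>q rs. program M (s + q) rs = embed M0 s e q rs"
    and "wf_conf M0 c" and "(step M0 \<phi>0 ^^ n) c = (q', us')"
  shows "reaches M \<phi> (s + fst c, t0 # t1 # t2 # snd c) (s + q', t0 # t1 # t2 # us') \<and> wf_conf M0 (q', us')"
  using assms(4)
proof (induction n arbitrary: q' us')
  case 0
  with assms(3) show ?case
    by (auto intro: reaches_refl)
next
  case (Suc n)
  obtain q us where c: "(step M0 \<phi>0 ^^ n) c = (q, us)"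
    by fastforce
  with Suc.IH have reach: "reaches M \<phi> (s + fst c, t0 # t1 # t2 # snd c) (s + q, t0 # t1 # t2 # us)"
    and wf: "wf_conf M0 (q, us)"
    by auto
  have succ: "step M0 \<phi>0 (q, us) = (q', us')"
    using Suc.prems c by simp
  from plain_machine_action[OF assms(1) wf]
  have "reaches M \<phi> (s + q, t0 # t1 # t2 # us) (s + q', t0 # t1 # t2 # us')"
  proof (elim disjE exE conjE)
    assume "program M0 q (map (\<lambda>t. t 0) us) = Halt"
    with succ show ?thesis
      by (auto intro: reaches_refl)
  next
    fix q'' ws
    assume "program M0 q (map (\<lambda>t. t 0) us) = Go q'' ws"
    with succ have "step M \<phi> (s + q, t0 # t1 # t2 # us) = (s + q', t0 # t1 # t2 # us')"
      by (auto simp: embed embed_def write_stay numeral_3_eq_3)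
    then show ?thesis
      using reaches_step[of M \<phi> "(s + q, t0 # t1 # t2 # us)"] by (simp only:)
  qed
  from reaches_trans[OF reach this] wf_conf_step[OF assms(1) wf, of \<phi>0] show ?case
    unfolding succ by (rule conjI)
qed


section \<open>The completing machine\<close>

text \<open>
  Tape 0 holds the input and the output, tape 1 the query and its answer, tape 2 the first component
  of the enumerated pair, and the remaining tapes belong to the machine \<open>M\<close> for the enumeration.
  States 0 and 1 decode the input, 2 queries, \<open>9 + q\<close> simulates \<open>M\<close>, 3 and 4 decode its output (with
  the candidate answer going to tape 0), 5 compares tapes 1 and 2 and halts if they agree. Otherwise
  6 erases tape 0 and goes to the end of tape 1, which is not erased by the comparison, and 7 copies
  it to tape 0.
\<close>

definition compare :: "(nat \<Rightarrow> nat) \<Rightarrow> nat \<times> (nat \<Rightarrow> nat \<times> move)" where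
  "compare r =
     (if r 1 = 0 \<or> r 2 = 0 then (6, stay r)
      else (5, (stay r)(1 := (r 1, Right), 2 := (r 2, Right))))"

definition rewind :: "(nat \<Rightarrow> nat) \<Rightarrow> nat \<times> (nat \<Rightarrow> nat \<times> move)" where
  "rewind r =
     (if r 0 \<noteq> 0 then (6, (stay r)(0 := (0, Right)))
      else if r 1 \<noteq> 0 then (6, (stay r)(1 := (r 1, Right)))
      else (7, (stay r)(1 := (r 1, Left))))"

definition copy :: "(nat \<Rightarrow> nat) \<Rightarrow> nat \<times> (nat \<Rightarrow> nat \<times> move)" where
  "copy r =
     (if r 1 = 0 then (8, (stay r)(0 := (r 0, Right)))
      else (7, (stay r)(0 := (1, Left), 1 := (r 1, Left))))"

definition completer_program :: "machine \<Rightarrow> nat \<Rightarrow> nat list \<Rightarrow> action" where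
  "completer_program M q rs =
    (let K = length rs; r = (!) rs in
     if q = 0 then go K (walk 0 2 0 1 3 r)
     else if q = 1 then go K (refill 0 1 3 r)
     else if q = 2 then Query 9
     else if q = 3 then go K (walk 3 5 3 2 0 r)
     else if q = 4 then go K (refill 3 2 0 r)
     else if q = 5 then (if r 1 = 0 \<and> r 2 = 0 then Halt else go K (compare r))
     else if q = 6 then go K (rewind r)
     else if q = 7 then go K (copy r)
     else if q = 8 then Halt
     else embed M 9 3 (q - 9) rs)"

definition completer :: "machine \<Rightarrow> machine" where
  "completer M = \<lparr>tapes = tapes M + 3, symbols = symbols M, states = 9 + states M,
     program = completer_program M\<rparr>"

section \<open>Well-formedness of the completing machine\<close>

lemma completer_sel [simp]:
  "tapes (completer M) = tapes M + 3" "symbols (completer M) = symbols M"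
  "states (completer M) = 9 + states M"
  by (simp_all add: completer_def)

lemma completer_program: "program (completer M) = completer_program M"
  by (simp add: completer_def)

text \<open>States 1 and 4 are written as sums to match the premises on \<open>s + 1\<close> in
  \<open>reaches_walk\<close>.\<close>

lemma program_completer:
  assumes "4 \<le> K"
  shows "program (completer M) 0 (map r [0..<K]) = go K (walk 0 2 0 1 3 r)"
    and "program (completer M) (0 + 1) (map r [0..<K]) = go K (refill 0 1 3 r)"
    and "program (completer M) 2 (map r [0..<K]) = Query 9"
    and "program (completer M) 3 (map r [0..<K]) = go K (walk 3 5 3 2 0 r)"
    and "program (completer M) (3 + 1) (map r [0..<K]) = go K (refill 3 2 0 r)"
    and "r 1 = 0 \<Longrightarrow> r 2 = 0 \<Longrightarrow> program (completer M) 5 (map r [0..<K]) = Halt"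
    and "r 1 \<noteq> 0 \<or> r 2 \<noteq> 0 \<Longrightarrow> program (completer M) 5 (map r [0..<K]) = go K (compare r)"
    and "program (completer M) 6 (map r [0..<K]) = go K (rewind r)"
    and "program (completer M) 7 (map r [0..<K]) = go K (copy r)"
    and "program (completer M) 8 (map r [0..<K]) = Halt"
    and "program (completer M) (9 + q) rs = embed M 9 3 q rs"
  using assms
  by (auto simp: completer_program completer_program_def go_def walk_def refill_def
      compare_def rewind_def copy_def
      stay_def Let_def numeral_2_eq_2)

lemma oracle_machine_completer:
  assumes "plain_machine M"
  shows "oracle_machine (completer M)"
proof -
  have M: "2 \<le> tapes M" "2 \<le> symbols M" "0 < states M"
    using assms by (auto simp: plain_machine_def oracle_machine_def)
  define K where "K = tapes M + 3"
  with M have K: "4 \<le> K"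
    by simp
  define ok where "ok act \<longleftrightarrow> (case act of
           Halt \<Rightarrow> True
         | Go q' ws \<Rightarrow> q' < 9 + states M \<and> length ws = K \<and> fst ` set ws \<subseteq> {..<symbols M}
         | Query q' \<Rightarrow> q' < 9 + states M)" for act
  \<comment> \<open>The bound 9 suffices: control enters the simulated states only by the
    query.\<close>
  have ok_go: "ok (go K p)" if "fst p < 9" "\<And>l. l < K \<Longrightarrow> fst (snd p l) < symbols M" for p
    using that by (auto simp: ok_def go_def)
  have "ok (completer_program M q rs)"
    if q: "q < 9 + states M" and rs: "scannable (completer M) rs" for q rs
  proof -
    have len: "length rs = K"
      using rs by (simp add: scannable_def K_def)
    then have symb: "rs ! l < symbols M" if "l < K" for l
      using rs that nth_mem[of l rs] unfolding scannable_def
      by (metis completer_sel(2) lessThan_iff subsetD)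
    show ?thesis
    proof (cases "q < 9")
      case True
      have walk: "ok (go K (walk s e i j k ((!) rs)))" if "s < 8" "e < 9" "j < K" for s e i j k
        using that M by (intro ok_go) (auto simp: walk_def stay_def symb)
      have refill: "ok (go K (refill s j k ((!) rs)))" if "s < 8" for s j k
        using that M by (intro ok_go) (auto simp: refill_def stay_def symb)
      have compare: "ok (go K (compare ((!) rs)))" and rewind: "ok (go K (rewind ((!) rs)))"
        and copy: "ok (go K (copy ((!) rs)))"
        using M by (intro ok_go; auto simp: compare_def rewind_def copy_def stay_def symb)+
      have "q = 0 \<or> q = 1 \<or> q = 2 \<or> q = 3 \<or> q = 4 \<or> q = 5 \<or> q = 6 \<or> q = 7 \<or> q = 8"
        using True by arith
      then show ?thesis
        unfolding completer_program_def Let_def len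
        by (elim disjE) (use M K in \<open>simp_all add: walk refill compare rewind copy ok_def[of Halt]
          ok_def[of "Query 9"]\<close>)
    next
      case False
      then obtain q0 where q0: "q = 9 + q0"
        using le_Suc_ex not_less by blast
      have "q0 < states M" "scannable M (drop 3 rs)"
        using q q0 rs by (auto simp: scannable_def dest: in_set_dropD)
      then have "case program M q0 (drop 3 rs) of
           Halt \<Rightarrow> True
         | Go q' ws \<Rightarrow> q' < states M \<and> length ws = tapes M \<and> fst ` set ws \<subseteq> {..<symbols M}
         | Query q' \<Rightarrow> q' < states M"
        using assms unfolding plain_machine_def oracle_machine_def by blast
      moreover have "set rs \<subseteq> {..<symbols M}"
        using rs by (simp add: scannable_def)
      ultimately have "ok (embed M 9 3 q0 rs)"
        unfolding embed_def ok_def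
        by (cases "program M q0 (drop 3 rs)") (auto simp: len K_def dest: in_set_takeD)
      then show ?thesis
        using q0 by (simp add: completer_program_def)
    qed
  qed
  then have "\<forall>q rs. q < states (completer M) \<and> scannable (completer M) rs \<longrightarrow>
      ok (program (completer M) q rs)"
    by (simp add: completer_program)
  with M show ?thesis
    unfolding oracle_machine_def ok_def K_def completer_sel by simp
qed

section \<open>Runs of the comparison and copying states\<close>

lemma reaches_compare:
  assumes "4 \<le> K"
  shows "reaches (completer M) \<phi>
    (conf K 5 (T(1 := segment (- int c) (int x + int m), 2 := segment (- int c) (int y + int m))))
    (conf K 5 (T(1 := segment (- int (c + m)) (int x), 2 := segment (- int (c + m)) (int y))))"
\<comment> \<open>Here \<open>c\<close> counts the strokes crossed so far; they remain on both tapes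
  to the left of the head.\<close>
proof (induction m arbitrary: c)
  case 0
  show ?case
    by (simp add: reaches_refl)
next
  case (Suc m)
  show ?case
    by (rule reaches_go[OF program_completer(7)[OF assms], rotated 3],
        rule Suc.IH[of "Suc c", unfolded add_Suc_shift])
      (auto simp: compare_def stay_def tape_simps minus_diff_commute)
qed

text \<open>The outer induction erases tape 0, the inner one crosses the rest of tape 1. The last
  move is to the left, onto the final stroke if there is one, whence the bound 1.\<close>

lemma reaches_rewind:
  assumes "4 \<le> K"
  shows "reaches (completer M) \<phi>
    (conf K 6 (T(0 := unary n, 1 := segment (- int c) (int x))))
    (conf K 7 (T(0 := segment 1 1, 1 := segment (1 - int (c + x)) 1)))"
proof (induction n)
  case 0
  show ?case
  proof (induction x arbitrary: c)
    case 0
    show ?case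
      by (rule reaches_go[OF program_completer(8)[OF assms] _ _ reaches_refl])
        (auto simp: rewind_def stay_def tape_simps unary_segment segment_empty)
  next
    case (Suc x)
    show ?case
      by (rule reaches_go[OF program_completer(8)[OF assms], rotated 2],
          rule Suc.IH[of "Suc c", unfolded add_Suc_shift])
        (auto simp: rewind_def stay_def tape_simps unary_segment minus_diff_commute)
  qed
next
  case (Suc n)
  show ?case
    by (rule reaches_go[OF program_completer(8)[OF assms] _ _ Suc.IH])
      (auto simp: rewind_def stay_def tape_simps unary_segment)
qed

text \<open>With \<open>k\<close> strokes copied and \<open>m\<close> still to copy,
  \<open>k + m\<close> is invariant. What remains on tape 1 does not matter, hence the existential
  \<open>t\<close>.\<close>

lemma reaches_copy:
  assumes "4 \<le> K"
  shows "\<exists>t. reaches (completer M) \<phi>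
    (conf K 7 (T(0 := segment 1 (1 + int k), 1 := segment (1 - int m) (1 + int k))))
    (conf K 8 (T(0 := unary (k + m), 1 := t)))"
proof (induction m arbitrary: k)
  case 0
  show ?case
    by (rule exI, rule reaches_go[OF program_completer(9)[OF assms] _ _ reaches_refl])
      (auto simp: copy_def stay_def tape_simps unary_segment)
next
  case (Suc m)
  obtain t where "reaches (completer M) \<phi>
    (conf K 7 (T(0 := segment 1 (1 + int (Suc k)), 1 := segment (1 - int m) (1 + int (Suc k)))))
    (conf K 8 (T(0 := unary (k + Suc m), 1 := t)))"
    using Suc.IH[of "Suc k", unfolded add_Suc_shift] by blast
  then have "reaches (completer M) \<phi>
    (conf K 7 (T(0 := segment 1 (1 + int k), 1 := segment (1 - int (Suc m)) (1 + int k))))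
    (conf K 8 (T(0 := unary (k + Suc m), 1 := t)))"
    by (rule reaches_go[OF program_completer(9)[OF assms], rotated 2])
      (auto simp: copy_def stay_def tape_simps)
  then show ?case
    by blast
qed

text \<open>After \<open>min x y\<close> common strokes at least one of the tapes 1 and 2 is
  exhausted, and both are exactly if \<open>x = y\<close>.\<close>

lemma reaches_verdict:
  assumes K: "4 \<le> K"
  shows "\<exists>c. reaches (completer M) \<phi> (conf K 5 (T(0 := unary b, 1 := unary x, 2 := unary y))) c \<and>
    next_action (completer M) c = Halt \<and> snd c ! 0 = unary (if x = y then b else x)"
proof -
  define m where "m = min x y"
  let ?T = "T(0 := unary b)"
  let ?S = "?T(1 := segment (- int m) (int (x - m)), 2 := segment (- int m) (int (y - m)))"
  have "reaches (completer M) \<phi>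
    (conf K 5 (?T(1 := segment (- int 0) (int (x - m) + int m), 2 := segment (- int 0) (int (y - m) + int m))))
    (conf K 5 (?T(1 := segment (- int (0 + m)) (int (x - m)), 2 := segment (- int (0 + m)) (int (y - m)))))"
    by (rule reaches_compare[OF K, of M \<phi> ?T])
  then have start: "reaches (completer M) \<phi> (conf K 5 (?T(1 := unary x, 2 := unary y))) (conf K 5 ?S)"
    by (simp add: unary_segment m_def flip: of_nat_add)
  show ?thesis
  proof (cases "x = y")
    case True
    then have halt: "next_action (completer M) (conf K 5 ?S) = Halt"
      unfolding next_action_conf by (intro program_completer[OF K]) (auto simp: segment_scan m_def)
    have written: "snd (conf K 5 ?S) ! 0 = unary b"
      using K by (simp add: conf_def)
    show ?thesis
      unfolding if_P[OF True] by (intro exI conjI, rule start, rule halt, rule written)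
  next
    case False
    let ?U = "T(2 := segment (- int m) (int (y - m)))"
    have "reaches (completer M) \<phi>
      (conf K 6 (?U(0 := unary b, 1 := segment (- int m) (int (x - m)))))
      (conf K 7 (?U(0 := segment 1 1, 1 := segment (1 - int (m + (x - m))) 1)))"
      by (rule reaches_rewind[OF K, of M \<phi> ?U])
    then have "reaches (completer M) \<phi>
      (conf K 6 (?U(0 := unary b, 1 := segment (- int m) (int (x - m)))))
      (conf K 7 (?U(0 := segment 1 1, 1 := segment (1 - int x) 1)))"
      by (simp add: m_def)
    moreover obtain t where "reaches (completer M) \<phi>
      (conf K 7 (?U(0 := segment 1 1, 1 := segment (1 - int x) 1)))
      (conf K 8 (?U(0 := unary x, 1 := t)))"
      using reaches_copy[OF K, of M \<phi> ?U 0 x] unfolding of_nat_0 add_0_right add_0 by blast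
    ultimately have "reaches (completer M) \<phi>
      (conf K 6 (?U(0 := unary b, 1 := segment (- int m) (int (x - m)))))
      (conf K 8 (?U(0 := unary x, 1 := t)))"
      by (rule reaches_trans)
    then have "reaches (completer M) \<phi> (conf K 5 ?S) (conf K 8 (?U(0 := unary x, 1 := t)))"
      by (rule reaches_go[OF program_completer(7)[OF K], rotated 3])
        (use False in \<open>auto simp: compare_def stay_def tape_simps m_def\<close>)
    with start have run: "reaches (completer M) \<phi> (conf K 5 (?T(1 := unary x, 2 := unary y)))
      (conf K 8 (?U(0 := unary x, 1 := t)))"
      by (rule reaches_trans)
    have halt: "next_action (completer M) (conf K 8 (?U(0 := unary x, 1 := t))) = Halt"
      unfolding next_action_conf by (rule program_completer(10)[OF K])
    have written: "snd (conf K 8 (?U(0 := unary x, 1 := t))) ! 0 = unary x"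
      using K by (simp add: conf_def)
    show ?thesis
      unfolding if_not_P[OF False] by (intro exI conjI, rule run, rule halt, rule written)
  qed
qed

lemma outputs_completer:
  assumes "plain_machine M" "computes M (\<lambda>_. 0) f"
    and "prod_decode n = (i, j)" "prod_decode (f j) = (a, b)"
  shows "outputs (completer M) \<phi> n (if \<phi> i = a then b else \<phi> i)"
proof -
  let ?M = "completer M"
  define K where "K = tapes M + 3"
  have M: "oracle_machine M" "2 \<le> tapes M"
    using assms(1) by (auto simp: plain_machine_def oracle_machine_def)
  then have K: "4 \<le> K"
    by (simp add: K_def)
  have zero: "prod_encode (0, 0) = 0"
    by (simp add: prod_encode_def)
  have encode: "prod_encode (i, j) = prod_encode (0, 0) + n" "prod_encode (a, b) = prod_encode (0, 0) + f j"
    using assms(3,4)[THEN arg_cong[of _ _ prod_encode]] by (simp_all add: zero)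
  \<comment> \<open>Tape 3 is tape 0 of \<open>M\<close>, so decoding \<open>j\<close> onto it
    already prepares the input of \<open>M\<close>.\<close>
  let ?B = "\<lambda>_::nat. unary 0"
  let ?B2 = "?B(0 := unary 0, 1 := unary i, 3 := unary j)"
  have start_conf: "start ?M n = conf K 0 (?B(0 := unary n, 1 := segment 1 (1 + int 0), 3 := unary 0))"
    by (rule prod_eqI, simp add: start_def conf_def, rule nth_equalityI)
      (auto simp: start_def conf_def K_def nth_Cons' unary_segment segment_empty)
  have decode_n: "reaches ?M \<phi> (conf K 0 (?B(0 := unary n, 1 := segment 1 (1 + int 0), 3 := unary 0)))
    (conf K 2 ?B2)"
    by (rule reaches_walk[OF program_completer(1)[OF K] program_completer(2)[OF K]])
      (simp_all add: encode(1))
  \<comment> \<open>The query leads to state 9, which is the start state 0 of the simulated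
    \<open>M\<close>.\<close>
  have query_step: "step ?M \<phi> (conf K 2 ?B2) =
    (9 + fst (start M j), unary 0 # unary (\<phi> i) # unary 0 # snd (start M j))"
  proof -
    have "next_action ?M (conf K 2 T) = Query 9" for T
      unfolding next_action_conf by (rule program_completer(3)[OF K])
    then have "step ?M \<phi> (conf K 2 T) = (9, (map T [0..<K])[1 := unary (\<phi> (strokes (T 1)))])" for T
      using K by (simp add: conf_def)
    then show ?thesis
      using M(2)
      by (auto simp: start_def K_def strokes_unary nth_Cons' nth_list_update intro!: nth_equalityI)
  qed
  have query: "reaches ?M \<phi> (start ?M n)
    (9 + fst (start M j), unary 0 # unary (\<phi> i) # unary 0 # snd (start M j))"
    using decode_n reaches_step[of ?M \<phi> "conf K 2 ?B2"] unfolding start_conf query_step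
    by (rule reaches_trans)
  obtain k q us where k: "(step M (\<lambda>_. 0) ^^ k) (start M j) = (q, us)"
    and halt: "next_action M (q, us) = Halt" and us: "us ! 0 = unary (f j)"
    using assms(2) unfolding computes_def outputs_def Let_def by (metis prod.collapse snd_conv)
  let ?c = "(9 + q, unary 0 # unary (\<phi> i) # unary 0 # us)"
  have run: "reaches ?M \<phi> (9 + fst (start M j), unary 0 # unary (\<phi> i) # unary 0 # snd (start M j)) ?c"
    and wf: "wf_conf M (q, us)"
    using reaches_embed[OF assms(1) program_completer(11)[OF K] wf_conf_start[OF M(1)] k] by auto
  \<comment> \<open>The other tapes keep whatever \<open>M\<close> left on them; only tapes 0 to 3
    matter from here on.\<close>
  let ?L = "\<lambda>l. (unary 0 # unary (\<phi> i) # unary 0 # us) ! l"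
  let ?T = "?L(3 := unary (f j), 2 := segment 1 (1 + int 0), 0 := unary 0)"
  let ?T' = "?L(3 := unary 0, 2 := unary a, 0 := unary b)"
  have exit_step: "step ?M \<phi> ?c = conf K 3 ?T"
  proof -
    have "step ?M \<phi> ?c = (3, unary 0 # unary (\<phi> i) # unary 0 # us)"
      using halt by (simp add: program_completer(11)[OF K] embed_def write_stay map2_write_stay comp_def
          numeral_3_eq_3)
    moreover have "unary 0 # unary (\<phi> i) # unary 0 # us = map ?T [0..<K]"
      using wf us
      by (intro nth_equalityI) (auto simp: wf_conf_def K_def nth_Cons' unary_segment segment_empty)
    ultimately show ?thesis
      by (simp only: conf_def)
  qed
  have decode_f: "reaches ?M \<phi> (conf K 3 ?T) (conf K 5 ?T')"
    by (rule reaches_walk[OF program_completer(4)[OF K] program_completer(5)[OF K]])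
      (simp_all add: encode(2))
  have "reaches ?M \<phi> (start ?M n) (conf K 5 ?T')"
    using reaches_trans[OF query reaches_trans[OF run reaches_step]] decode_f
    unfolding exit_step by (rule reaches_trans)
  moreover have "?T' = ?L(3 := unary 0, 0 := unary b, 1 := unary (\<phi> i), 2 := unary a)"
    by (auto simp: fun_eq_iff)
  ultimately have verdict: "reaches ?M \<phi> (start ?M n)
      (conf K 5 (?L(3 := unary 0, 0 := unary b, 1 := unary (\<phi> i), 2 := unary a)))"
    by (simp only:)
  obtain c where c_reached: "reaches ?M \<phi>
      (conf K 5 (?L(3 := unary 0, 0 := unary b, 1 := unary (\<phi> i), 2 := unary a))) c"
    and c: "next_action ?M c = Halt" "snd c ! 0 = unary (if \<phi> i = a then b else \<phi> i)"
    using reaches_verdict[OF K, of M \<phi> "?L(3 := unary 0)" b "\<phi> i" a] by blast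
  have "reaches ?M \<phi> (start ?M n) c"
    by (rule reaches_trans[OF verdict c_reached])
  with c show ?thesis
    unfolding outputs_iff_reaches by blast
qed

text \<open>Uniformity is the order of quantifiers: \<open>M\<close> is chosen before
  \<open>x\<close> and \<open>\<phi>\<close>.\<close>

theorem theorem7:
  fixes X :: "'a topology" and \<B> :: "'a set set" and \<nu> :: "nat \<rightharpoonup> 'a set"
  assumes "effective_topology X \<B> \<nu>" and "re_subset_relation \<B> \<nu>"
  shows "\<exists>M. oracle_machine M \<and>
    (\<forall>x\<in>topspace X. \<forall>\<phi>. oracle_for \<B> \<nu> x \<phi> \<longrightarrow>
       (\<exists>\<psi>. complete_oracle_for \<B> \<nu> x \<psi> \<and> computes M \<phi> \<psi>))"
proof -
  let ?C = "code_dom \<B> \<nu>"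
  define S where "S = {prod_encode (b1, b2) | b1 b2. b1 \<in> ?C \<and> b2 \<in> ?C \<and> the (\<nu> b1) \<subseteq> the (\<nu> b2)}"
  have in_S: "prod_encode (b1, b2) \<in> S \<longleftrightarrow> b1 \<in> ?C \<and> b2 \<in> ?C \<and> the (\<nu> b1) \<subseteq> the (\<nu> b2)" for b1 b2
    by (auto simp: S_def)
  consider "S = {}" | M f where "plain_machine M" "computes M (\<lambda>_. 0) f" "S = range f"
    using assms(2) unfolding re_subset_relation_def recursively_enumerable_def recursive_def S_def
    by blast
  then show ?thesis
  proof cases
    case 1
    \<comment> \<open>By reflexivity each code \<open>b\<close> would put
      \<open>prod_encode (b, b)\<close> into \<open>S\<close>. Without codes there are no oracles,
      so any machine will do.\<close>
    then have "?C = {}"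
      using in_S by blast
    then have "\<not> oracle_for \<B> \<nu> x \<phi>" for x \<phi>
      by (auto simp: oracle_for_def)
    moreover have "oracle_machine \<lparr>tapes = 2, symbols = 2, states = 1, program = \<lambda>_ _. Halt\<rparr>"
      by (simp add: oracle_machine_def)
    ultimately show ?thesis
      by blast
  next
    case 2
    have "\<exists>\<psi>. complete_oracle_for \<B> \<nu> x \<psi> \<and> computes (completer M) \<phi> \<psi>"
      if \<phi>: "oracle_for \<B> \<nu> x \<phi>" for x \<phi>
    proof -
      define \<psi> where "\<psi> n = (case prod_decode n of (i, j) \<Rightarrow> case prod_decode (f j) of (a, b) \<Rightarrow>
        if \<phi> i = a then b else \<phi> i)" for n
      have "computes (completer M) \<phi> \<psi>"
        unfolding computes_def
      proof
        fix n
        obtain i j a b where ij: "prod_decode n = (i, j)" "prod_decode (f j) = (a, b)"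
          by (metis surj_pair)
        then show "outputs (completer M) \<phi> n (\<psi> n)"
          using outputs_completer[OF 2(1,2) ij] by (simp add: \<psi>_def)
      qed
      have \<phi>_dom: "\<phi> i \<in> ?C" and \<phi>_mem: "x \<in> the (\<nu> (\<phi> i))" for i
        using \<phi> by (auto simp: oracle_for_def local_basis_def)
      have in_basis: "the (\<nu> b) \<in> \<B>" if "b \<in> ?C" for b
        using that by (auto simp: code_dom_def)
      have sound: "\<psi> n \<in> ?C \<and> x \<in> the (\<nu> (\<psi> n))" for n
      proof -
        obtain i j a b where ij: "prod_decode n = (i, j)" "prod_decode (f j) = (a, b)"
          by (metis surj_pair)
        then have "prod_encode (a, b) \<in> S"
          using 2(3) by (metis prod_decode_inverse rangeI)
        with in_S \<phi>_dom \<phi>_mem ij show ?thesis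
          by (auto simp: \<psi>_def)
      qed
      have complete: "b \<in> range \<psi>" if b: "b \<in> ?C" "x \<in> the (\<nu> b)" for b
      proof -
        obtain i where "the (\<nu> (\<phi> i)) \<subseteq> the (\<nu> b)"
          using \<phi> b in_basis unfolding oracle_for_def local_basis_def by auto
        then have "prod_encode (\<phi> i, b) \<in> S"
          using in_S \<phi>_dom b by simp
        then obtain j where "f j = prod_encode (\<phi> i, b)"
          using 2(3) by auto
        then have "\<psi> (prod_encode (i, j)) = b"
          by (simp add: \<psi>_def)
        then show ?thesis
          by blast
      qed
      have "oracle_for \<B> \<nu> x \<psi>"
        unfolding oracle_for_def local_basis_def
      proof (intro conjI ballI impI)
        show "range \<psi> \<subseteq> ?C"
          using sound by auto
        show "(\<lambda>n. the (\<nu> n)) ` range \<psi> \<subseteq> \<B>"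
          using sound in_basis by blast
        show "x \<in> L" if "L \<in> (\<lambda>n. the (\<nu> n)) ` range \<psi>" for L
          using sound that by auto
        show "\<exists>L\<in>(\<lambda>n. the (\<nu> n)) ` range \<psi>. L \<subseteq> B" if B: "B \<in> \<B>" "x \<in> B" for B
        proof -
          obtain i where "the (\<nu> (\<phi> i)) \<subseteq> B"
            using \<phi> B unfolding oracle_for_def local_basis_def by auto
          \<comment> \<open>Completeness applies to the values of \<open>\<phi>\<close> themselves,
            so \<open>\<psi>\<close> inherits the local basis.\<close>
          moreover have "\<phi> i \<in> range \<psi>"
            by (rule complete[OF \<phi>_dom \<phi>_mem])
          ultimately show ?thesis
            by blast
        qed
      qed
      with complete \<open>computes (completer M) \<phi> \<psi>\<close> show ?thesis
        unfolding complete_oracle_for_def by blast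
    qed
    with oracle_machine_completer[OF 2(1)] show ?thesis
      by blast
  qed
qed

end
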